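(* Consider the problem $\min_{x\in\mathcal X} f(x)$, $f=\frac1n\sum_{i=1}^n f_i$, where $\mathcal X\subset\mathbb R^d$ is nonempty, convex and compact with $\|x-y\|\le D$ for all $x,y\in\mathcal X$; $f$ is $L$-smooth on $\mathcal X$; each $f_i$ is $L_i$-smooth on $\mathcal X$; and $f$ is convex on $\mathcal X$ (the individual $f_i$ need not be convex). Let $\tilde L^2=\frac1n\sum_{i=1}^n L_i^2$ and let $x^*$ be a minimizer of $f$ on $\mathcal X$. Run the Sarah Frank-Wolfe algorithm (described in the context) with batch size $b$, probability $p=\frac{2b}{n+2b}$, and, for a total number $K$ of iterations, the step sizes ($0\le k\le K-1$) $$\eta_k=\begin{cases}\dfrac p2, & \text{if } K\le \dfrac2p,\\[2mm] \dfrac p2, & \text{if } K>\dfrac 2p \text{ and } k<\lceil K/2\rceil,\\[2mm] \dfrac{2}{4/p+k-\lceil K/2\rceil}, & \text{if } K>\dfrac2p\text{ and } k\ge\lceil K/2\rceil.\end{cases}$$ Then $\varepsilon$-suboptimality in expectation, i.e. $\mathbb E[f(x^K)-f(x^* )]\le\varepsilon$ for a suitable number of iterations $K=K(\varepsilon)$, is achieved with $$\mathcal O\left(\frac nb\log\frac1\varepsilon+\left[1+\frac{\tilde L\sqrt n}{bL}\right]\frac{LD^2}{\varepsilon}\right)\ \text{ LMO calls,}$$ and $$\mathcal O\left(n\log\frac1\varepsilon+\left[b+\frac{\tilde L\sqrt n}{L}\right]\frac{LD^2}{\varepsilon}\right)\ \text{ stochastic oracle calls (in expectation).}$$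
   Context: Norms and inner products are Euclidean and $[n]=\{1,\dots,n\}$. The $f_i$ are real-valued and differentiable on $\mathcal X$ (say, on an open neighbourhood of $\mathcal X$). A function $h$ is $M$-smooth on $\mathcal X$ ($M>0$) if $\|\nabla h(x)-\nabla h(y)\|\le M\|x-y\|$ for all $x,y\in\mathcal X$. Convexity of $f$ on $\mathcal X$ means $f(x)\ge f(y)+\langle\nabla f(y),x-y\rangle$ for all $x,y\in\mathcal X$. The constants satisfy $L,L_i,D>0$. Sarah Frank-Wolfe algorithm. Parameters: step sizes $\{\eta_k\}$, probability $p$, integer batch size $b$ with $1\le b\le n$. Initialization: $x^0\in\mathcal X$ (deterministic), $g^0=\nabla f(x^0)$. For $k=0,1,\dots,K-1$: (1) $s^k\in\arg\min_{s\in\mathcal X}\langle g^k,s\rangle$ (any minimizer, chosen as a measurable function of the past); (2) $x^{k+1}=x^k+\eta_k(s^k-x^k)$; (3) draw a batch $S_k$ of $b$ indices uniformly at random from $[n]$ (i.i.d., with repetitions counted in sums over $S_k$), independent of the past; (4) with probability $p$ (independently of everything else) set $g^{k+1}=\nabla f(x^{k+1})$; otherwise, with probability $1-p$, set $g^{k+1}=g^k+\frac1b\sum_{i\in S_k}[\nabla f_i(x^{k+1})-\nabla f_i(x^k)]$. Complexity measures. Each execution of step (1) is one LMO (linear minimization oracle) call, so $K$ iterations use $K$ LMO calls. A stochastic oracle call is one evaluation of a gradient $\nabla f_i$ at a point; evaluating $\nabla f$ costs $n$ calls. Thus the initialization costs $n$ calls and each iteration costs $pn+(1-p)\cdot 2b$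 calls in expectation. Meaning of $\mathcal O$: there is an absolute constant $C$ such that for every problem instance, $x^0$ and $b$ there is $\varepsilon_0>0$ such that for all $0<\varepsilon\le\varepsilon_0$ there is a $K$ achieving $\varepsilon$-suboptimality for which both counts are at most $C$ times the displayed expressions. *)

theory Defs
  imports "HOL-Probability.Probability"
begin

section \<open>Euclidean space with the dimension as a term\<close>

text \<open>The constant hidden in the O-notation has to be independent of the dimension d, so d must be
  bound inside the scope of that constant and cannot be a type. All R^d are therefore taken as the
  coordinate subspaces \<^term>\<open>eucl d\<close> of one inner product space, the finitely supported real
  sequences. On \<^term>\<open>eucl d\<close>, inner product, norm and topology are the Euclidean ones.\<close>

typedef fseq = "{x :: nat \<Rightarrow> real. finite {i. x i \<noteq> 0}}"
  morphisms coord Abs_fseq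
  by (rule exI[of _ "\<lambda>_. 0"]) simp

setup_lifting type_definition_fseq

instantiation fseq :: real_vector
begin

lift_definition zero_fseq :: fseq is "\<lambda>_. 0" by simp

lift_definition plus_fseq :: "fseq \<Rightarrow> fseq \<Rightarrow> fseq" is "\<lambda>x y i. x i + y i"
proof -
  fix x y :: "nat \<Rightarrow> real"
  assume "finite {i. x i \<noteq> 0}" "finite {i. y i \<noteq> 0}"
  then show "finite {i. x i + y i \<noteq> 0}"
    by (rule_tac finite_subset[of _ "{i. x i \<noteq> 0} \<union> {i. y i \<noteq> 0}"]) auto
qed

lift_definition minus_fseq :: "fseq \<Rightarrow> fseq \<Rightarrow> fseq" is "\<lambda>x y i. x i - y i"
proof -
  fix x y :: "nat \<Rightarrow> real"
  assume "finite {i. x i \<noteq> 0}" "finite {i. y i \<noteq> 0}"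
  then show "finite {i. x i - y i \<noteq> 0}"
    by (rule_tac finite_subset[of _ "{i. x i \<noteq> 0} \<union> {i. y i \<noteq> 0}"]) auto
qed

lift_definition uminus_fseq :: "fseq \<Rightarrow> fseq" is "\<lambda>x i. - x i" by simp

lift_definition scaleR_fseq :: "real \<Rightarrow> fseq \<Rightarrow> fseq" is "\<lambda>c x i. c * x i"
  by (erule finite_subset[rotated]) auto

instance
  by standard (transfer; auto simp: algebra_simps)+

end

instantiation fseq :: real_inner
begin

definition inner_fseq :: "fseq \<Rightarrow> fseq \<Rightarrow> real" where
  "inner_fseq x y = (\<Sum>i | coord x i \<noteq> 0. coord x i * coord y i)"

definition norm_fseq :: "fseq \<Rightarrow> real" where
  "norm_fseq x = sqrt (inner x x)"

definition sgn_fseq :: "fseq \<Rightarrow> fseq" where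
  "sgn_fseq x = x /\<^sub>R norm x"

definition dist_fseq :: "fseq \<Rightarrow> fseq \<Rightarrow> real" where
  "dist_fseq x y = norm (x - y)"

definition uniformity_fseq :: "(fseq \<times> fseq) filter" where
  "uniformity_fseq = (INF e\<in>{0<..}. principal {(x, y). dist x y < e})"

definition open_fseq :: "fseq set \<Rightarrow> bool" where
  "open_fseq U \<longleftrightarrow> (\<forall>x\<in>U. \<forall>\<^sub>F (x', y) in uniformity. x' = x \<longrightarrow> y \<in> U)"

lemma finite_coord: "finite {i. coord x i \<noteq> 0}"
  using coord[of x] by simp

lemma inner_fseq_superset:
  assumes "finite A" "\<And>i. i \<notin> A \<Longrightarrow> coord x i * coord y i = 0"
  shows "inner x y = (\<Sum>i\<in>A. coord x i * coord y i)"
proof -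
  have "(\<Sum>i | coord x i \<noteq> 0. coord x i * coord y i)
      = (\<Sum>i\<in>A \<union> {i. coord x i \<noteq> 0}. coord x i * coord y i)"
    by (rule sum.mono_neutral_left) (use assms finite_coord in auto)
  also have "\<dots> = (\<Sum>i\<in>A. coord x i * coord y i)"
    by (rule sum.mono_neutral_right) (use assms finite_coord in auto)
  finally show ?thesis
    by (simp add: inner_fseq_def)
qed

instance
proof
  fix x y z :: fseq and r :: real and U :: "fseq set"
  show "dist x y = norm (x - y)" by (rule dist_fseq_def)
  show "sgn x = x /\<^sub>R norm x" by (rule sgn_fseq_def)
  show "uniformity = (INF e\<in>{0<..}. principal {(x::fseq, y). dist x y < e})"
    by (rule uniformity_fseq_def)
  show "open U \<longleftrightarrow> (\<forall>x\<in>U. \<forall>\<^sub>F (x', y) in uniformity. x' = x \<longrightarrow> y \<in> U)"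
    by (rule open_fseq_def)
  let ?A = "{i. coord x i \<noteq> 0} \<union> {i. coord y i \<noteq> 0} \<union> {i. coord z i \<noteq> 0}"
  have fin: "finite ?A" by (simp add: finite_coord)
  show "inner x y = inner y x"
    by (subst (1 2) inner_fseq_superset[OF fin]) (auto simp: mult.commute)
  show "inner (x + y) z = inner x z + inner y z"
    by (subst (1 2 3) inner_fseq_superset[OF fin])
       (auto simp: plus_fseq.rep_eq distrib_right sum.distrib)
  show "inner (r *\<^sub>R x) y = r * inner x y"
    by (subst (1 2) inner_fseq_superset[OF fin])
       (auto simp: scaleR_fseq.rep_eq sum_distrib_left mult.assoc)
  show "0 \<le> inner x x"
    by (auto simp: inner_fseq_def intro: sum_nonneg)
  show "inner x x = 0 \<longleftrightarrow> x = 0"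
  proof
    assume "inner x x = 0"
    then have "\<forall>i\<in>{i. coord x i \<noteq> 0}. coord x i * coord x i = 0"
      unfolding inner_fseq_def by (subst (asm) sum_nonneg_eq_0_iff) (auto simp: finite_coord)
    then have "coord x = coord 0" by (auto simp: zero_fseq.rep_eq)
    then show "x = 0" by (simp add: coord_inject)
  qed (simp add: inner_fseq_def zero_fseq.rep_eq)
  show "norm x = sqrt (inner x x)" by (rule norm_fseq_def)
qed

end

definition eucl :: "nat \<Rightarrow> fseq set" where
  "eucl d = {x. \<forall>i\<ge>d. coord x i = 0}"

lemma inner_eucl: "x \<in> eucl d \<Longrightarrow> inner x y = (\<Sum>i<d. coord x i * coord y i)"
  by (rule inner_fseq_superset) (auto simp: eucl_def)

lemma norm_eucl: "x \<in> eucl d \<Longrightarrow> norm x = sqrt (\<Sum>i<d. (coord x i)\<^sup>2)"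
  by (simp add: norm_fseq_def inner_eucl power2_eq_square)

lemma coord_bij_eucl: "bij_betw coord (eucl d) {x. \<forall>i\<ge>d. x i = 0}"
proof (rule bij_betwI[where g = Abs_fseq])
  have "coord (Abs_fseq x) = x" if "\<forall>i\<ge>d. x i = 0" for x
    by (rule Abs_fseq_inverse)
       (use that in \<open>auto intro!: finite_subset[of _ "{..<d}"] simp: not_less[symmetric]\<close>)
  then show "Abs_fseq \<in> {x. \<forall>i\<ge>d. x i = 0} \<rightarrow> eucl d"
    and "\<And>y. y \<in> {x. \<forall>i\<ge>d. x i = 0} \<Longrightarrow> coord (Abs_fseq y) = y"
    by (auto simp: eucl_def)
qed (auto simp: eucl_def coord_inverse)


section \<open>Smoothness and convexity\<close>

text \<open>Derivatives are taken within \<^term>\<open>eucl d\<close>: only the values of a function on R^d matter.\<close>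

definition grad :: "nat \<Rightarrow> (fseq \<Rightarrow> real) \<Rightarrow> fseq \<Rightarrow> fseq" where
  "grad d h x = (THE v. v \<in> eucl d \<and> (h has_derivative (\<lambda>u. inner v u)) (at x within eucl d))"

definition differentiable_near :: "nat \<Rightarrow> fseq set \<Rightarrow> (fseq \<Rightarrow> real) \<Rightarrow> bool" where
  "differentiable_near d X h \<longleftrightarrow>
     (\<exists>U. open U \<and> X \<subseteq> U \<and> (\<forall>x\<in>U \<inter> eucl d. h differentiable (at x within eucl d)))"

definition grad_smooth_on :: "nat \<Rightarrow> fseq set \<Rightarrow> real \<Rightarrow> (fseq \<Rightarrow> real) \<Rightarrow> bool" where
  "grad_smooth_on d X M h \<longleftrightarrow>
     (\<forall>x\<in>X. \<forall>y\<in>X. norm (grad d h x - grad d h y) \<le> M * norm (x - y))"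

definition grad_convex_on :: "nat \<Rightarrow> fseq set \<Rightarrow> (fseq \<Rightarrow> real) \<Rightarrow> bool" where
  "grad_convex_on d X h \<longleftrightarrow> (\<forall>x\<in>X. \<forall>y\<in>X. h x \<ge> h y + inner (grad d h y) (x - y))"

definition mean_fun :: "nat \<Rightarrow> (nat \<Rightarrow> fseq \<Rightarrow> real) \<Rightarrow> fseq \<Rightarrow> real" where
  "mean_fun n f x = (1 / real n) * (\<Sum>i=1..n. f i x)"


section \<open>Sarah Frank-Wolfe\<close>

text \<open>The randomness of one iteration is the batch (a list, so repetitions count) together with the
  coin, which is \<^term>\<open>True\<close> with probability p. A history lists these draws, most recent
  iteration first. All earlier quantities of a run are functions of the history, so a choice of LMO
  answers that depends on the past is a function of the history.\<close>

type_synonym draw = "nat list \<times> bool"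

definition draw_pmf :: "nat \<Rightarrow> nat \<Rightarrow> real \<Rightarrow> draw pmf" where
  "draw_pmf n b p = pair_pmf (replicate_pmf b (pmf_of_set {1..n})) (bernoulli_pmf p)"

definition history_pmf :: "nat \<Rightarrow> nat \<Rightarrow> real \<Rightarrow> nat \<Rightarrow> draw list pmf" where
  "history_pmf n b p k = replicate_pmf k (draw_pmf n b p)"

text \<open>The state after a history of length k is the pair of x^k and g^k.\<close>

primrec sarah_fw ::
  "nat \<Rightarrow> nat \<Rightarrow> nat \<Rightarrow> (nat \<Rightarrow> fseq \<Rightarrow> real) \<Rightarrow> (nat \<Rightarrow> real) \<Rightarrow> fseq
    \<Rightarrow> (draw list \<Rightarrow> fseq) \<Rightarrow> draw list \<Rightarrow> fseq \<times> fseq" where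
  "sarah_fw d n b f \<eta> x0 lmo [] = (x0, grad d (mean_fun n f) x0)"
| "sarah_fw d n b f \<eta> x0 lmo (\<omega> # hs) =
     (let (x, g) = sarah_fw d n b f \<eta> x0 lmo hs;
          (S, coin) = \<omega>;
          x' = x + \<eta> (length hs) *\<^sub>R (lmo hs - x);
          g' = (if coin then grad d (mean_fun n f) x'
                else g + (1 / real b) *\<^sub>R (\<Sum>i\<leftarrow>S. (grad d (f i) x' - grad d (f i) x)))
      in (x', g'))"

definition valid_lmo ::
  "nat \<Rightarrow> nat \<Rightarrow> nat \<Rightarrow> real \<Rightarrow> fseq set \<Rightarrow> (nat \<Rightarrow> fseq \<Rightarrow> real) \<Rightarrow> (nat \<Rightarrow> real) \<Rightarrow> fseq
    \<Rightarrow> nat \<Rightarrow> (draw list \<Rightarrow> fseq) \<Rightarrow> bool" where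
  "valid_lmo d n b p X f \<eta> x0 K lmo \<longleftrightarrow>
     (\<forall>k<K. \<forall>hs\<in>set_pmf (history_pmf n b p k).
        is_arg_min (\<lambda>s. inner (snd (sarah_fw d n b f \<eta> x0 lmo hs)) s) (\<lambda>s. s \<in> X) (lmo hs))"

primrec oracle_calls :: "nat \<Rightarrow> draw list \<Rightarrow> nat" where
  "oracle_calls n [] = n"
| "oracle_calls n (\<omega> # hs) =
     oracle_calls n hs + (case \<omega> of (S, coin) \<Rightarrow> if coin then n else 2 * length S)"

definition step_size :: "real \<Rightarrow> nat \<Rightarrow> nat \<Rightarrow> real" where
  "step_size p K k =
     (if real K \<le> 2 / p then p / 2
      else if int k < \<lceil>real K / 2\<rceil> then p / 2
      else 2 / (4 / p + real k - real_of_int \<lceil>real K / 2\<rceil>))"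

end

theory Submission
  imports Defs
begin

text \<open>Write h for the optimality gap f(x) - f(x*), e for the norm of the error g - grad f(x) of the
  gradient estimate, and M for the mean of the squares of the L_i. Two inequalities hold for one step
  with step size \<eta>, conditionally on the past. The descent lemma, convexity and the minimality
  of s for g give h' \<le> (1 - \<eta>) h + \<eta> D e + L \<eta>^2 D^2 / 2 (lemma \<open>frank_wolfe_gap\<close>).
  Since the batch is independent and unbiased, the squared error satisfies
  E e'^2 \<le> (1 - p) (e^2 + M \<eta>^2 D^2 / b) (the restart with probability p, and lemma
  \<open>recursive_estimator_error\<close>).

  The Lyapunov function \<Phi> = h + c e^2 combines them: Young's inequality splits \<eta> D e, half of
  the contraction of c e^2 absorbs the e^2 so produced, and the other half suffices for a contraction
  by 1 - \<eta> because \<eta> \<le> p / 2. Hence E \<Phi>' \<le> (1 - \<eta>) \<Phi> + \<eta>^2 A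
  (lemma \<open>lyapunov_step\<close>), and the best c gives A = D^2 (L / 2 + sqrt (M n) / b) for
  p = 2 b / (n + 2 b).

  The rest is a scalar recursion (lemma \<open>two_phase_recursion\<close>). For K = 2 N, the N steps of size
  p / 2 shrink the initial gap by (1 - p / 2)^N and leave noise p A / 2; the N steps of decreasing
  size bring the noise down to 8 A / (4 / p + N). So N of order A / \<epsilon> + (1 / p) ln (1 / \<epsilon>)
  suffices, where 1 / p is of order n / b. An iteration costs p n + (1 - p) 2 b \<le> 4 b oracle calls
  in expectation, which turns the bound on K into the bound on oracle calls.\<close>

section \<open>Gradients on a coordinate subspace\<close>

lemma eucl_add: "x \<in> eucl d \<Longrightarrow> y \<in> eucl d \<Longrightarrow> x + y \<in> eucl d"
  by (simp add: eucl_def plus_fseq.rep_eq)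

lemma eucl_diff: "x \<in> eucl d \<Longrightarrow> y \<in> eucl d \<Longrightarrow> x - y \<in> eucl d"
  by (simp add: eucl_def minus_fseq.rep_eq)

lemma eucl_scaleR: "x \<in> eucl d \<Longrightarrow> c *\<^sub>R x \<in> eucl d"
  by (simp add: eucl_def scaleR_fseq.rep_eq)

lemma coord_sum: "coord (\<Sum>i\<in>A. g i) j = (\<Sum>i\<in>A. coord (g i) j)"
  by (induction A rule: infinite_finite_induct) (simp_all add: zero_fseq.rep_eq plus_fseq.rep_eq)

lemma eucl_sum: "(\<And>i. i \<in> A \<Longrightarrow> g i \<in> eucl d) \<Longrightarrow> (\<Sum>i\<in>A. g i) \<in> eucl d"
  by (simp add: eucl_def coord_sum)

text \<open>The standard basis vectors.\<close>

definition unit_fseq :: "nat \<Rightarrow> fseq" where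
  "unit_fseq i = Abs_fseq (\<lambda>j. if j = i then 1 else 0)"

lemma coord_unit: "coord (unit_fseq i) j = (if j = i then 1 else 0)"
  unfolding unit_fseq_def
  by (subst Abs_fseq_inverse) (auto intro!: finite_subset[of _ "{i}"] split: if_splits)

lemma eucl_expansion:
  assumes "u \<in> eucl d"
  shows "u = (\<Sum>i<d. coord u i *\<^sub>R unit_fseq i)"
proof -
  have "coord u j = coord (\<Sum>i<d. coord u i *\<^sub>R unit_fseq i) j" for j
    using assms by (simp add: coord_sum scaleR_fseq.rep_eq coord_unit eucl_def if_distrib cong: if_cong)
  then have "coord u = coord (\<Sum>i<d. coord u i *\<^sub>R unit_fseq i)" by (rule ext)
  then show ?thesis by (simp only: coord_inject)
qed

text \<open>A line inside the subspace turns a derivative within the subspace into a two-sided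
  one-dimensional derivative, also at boundary points of the feasible set.\<close>

lemma has_derivative_along_line:
  fixes h :: "fseq \<Rightarrow> real"
  assumes "(h has_derivative (\<lambda>u. inner v u)) (at (x + t *\<^sub>R u) within eucl d)"
    and "x \<in> eucl d" "u \<in> eucl d"
  shows "((\<lambda>s. h (x + s *\<^sub>R u)) has_real_derivative inner v u) (at t)"
proof -
  have line: "((\<lambda>s. x + s *\<^sub>R u) has_derivative (\<lambda>s. s *\<^sub>R u)) (at t)"
    by (auto intro!: derivative_eq_intros)
  have "((\<lambda>s. h (x + s *\<^sub>R u)) has_derivative (\<lambda>s. inner v (s *\<^sub>R u))) (at t)"
    by (rule has_derivative_in_compose[OF line has_derivative_subset[OF assms(1)]])
       (use assms in \<open>auto intro: eucl_add eucl_scaleR\<close>)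
  then show ?thesis
    by (simp add: has_field_derivative_def mult_commute_abs)
qed

lemma gradient_unique:
  fixes h :: "fseq \<Rightarrow> real"
  assumes "x \<in> eucl d" "v \<in> eucl d" "w \<in> eucl d"
    and "(h has_derivative (\<lambda>u. inner v u)) (at x within eucl d)"
    and "(h has_derivative (\<lambda>u. inner w u)) (at x within eucl d)"
  shows "v = w"
proof -
  let ?u = "v - w"
  have "?u \<in> eucl d" using assms by (simp add: eucl_diff)
  then have "((\<lambda>s. h (x + s *\<^sub>R ?u)) has_real_derivative inner v ?u) (at 0)"
       "((\<lambda>s. h (x + s *\<^sub>R ?u)) has_real_derivative inner w ?u) (at 0)"
    using assms by (auto intro!: has_derivative_along_line)
  then have "inner v ?u = inner w ?u" by (rule DERIV_unique)
  then have "inner ?u ?u = 0" by (simp add: inner_diff_left)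
  then show ?thesis by simp
qed

lemma grad_eqI:
  assumes "x \<in> eucl d" "v \<in> eucl d" "(h has_derivative (\<lambda>u. inner v u)) (at x within eucl d)"
  shows "grad d h x = v"
  unfolding grad_def using assms gradient_unique by (intro the_equality) auto

text \<open>The derivative is a linear form on all finitely supported sequences, which need not be
  represented by a vector; its restriction to the subspace is.\<close>

lemma grad_works:
  fixes h :: "fseq \<Rightarrow> real"
  assumes x: "x \<in> eucl d" and diff: "h differentiable (at x within eucl d)"
  shows "grad d h x \<in> eucl d"
    and "(h has_derivative (\<lambda>u. inner (grad d h x) u)) (at x within eucl d)"
proof -
  obtain h' where h': "(h has_derivative h') (at x within eucl d)"
    using diff by (auto simp: differentiable_def)
  interpret h': bounded_linear h' using h' by (rule has_derivative_bounded_linear)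
  define v where "v = (\<Sum>i<d. h' (unit_fseq i) *\<^sub>R unit_fseq i)"
  have v: "v \<in> eucl d"
    unfolding v_def by (intro eucl_sum eucl_scaleR) (auto simp: eucl_def coord_unit)
  have coord_v: "coord v i = h' (unit_fseq i)" if "i < d" for i
    unfolding v_def using that
    by (simp add: coord_sum scaleR_fseq.rep_eq coord_unit if_distrib cong: if_cong)
  have eq: "h' u = inner v u" if u: "u \<in> eucl d" for u
  proof -
    have "h' u = (\<Sum>i<d. coord u i * h' (unit_fseq i))"
      by (subst eucl_expansion[OF u]) (simp add: h'.sum h'.scaleR)
    also have "\<dots> = inner v u"
      by (simp add: inner_eucl[OF v] coord_v mult.commute)
    finally show ?thesis .
  qed
  have "(h has_derivative (\<lambda>u. inner v u)) (at x within eucl d)"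
    unfolding has_derivative_within
  proof
    show "((\<lambda>y. (1 / norm (y - x)) *\<^sub>R (h y - (h x + inner v (y - x)))) \<longlongrightarrow> 0) (at x within eucl d)"
    proof (rule Lim_transform_eventually)
      show "((\<lambda>y. (1 / norm (y - x)) *\<^sub>R (h y - (h x + h' (y - x)))) \<longlongrightarrow> 0) (at x within eucl d)"
        using h' by (simp add: has_derivative_within)
      show "\<forall>\<^sub>F y in at x within eucl d. (1 / norm (y - x)) *\<^sub>R (h y - (h x + h' (y - x)))
          = (1 / norm (y - x)) *\<^sub>R (h y - (h x + inner v (y - x)))"
        using x by (auto simp: eventually_at_filter eq eucl_diff)
    qed
  qed (rule bounded_linear_inner_right)
  with grad_eqI[OF x v this] v
  show "grad d h x \<in> eucl d"
    and "(h has_derivative (\<lambda>u. inner (grad d h x) u)) (at x within eucl d)" by simp_all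
qed

lemma has_derivative_mean_fun:
  assumes x: "x \<in> eucl d" and diff: "\<And>i. i \<in> {1..n} \<Longrightarrow> f i differentiable (at x within eucl d)"
  shows "(mean_fun n f has_derivative
           (\<lambda>u. inner ((1 / real n) *\<^sub>R (\<Sum>i=1..n. grad d (f i) x)) u)) (at x within eucl d)"
proof -
  have "((\<lambda>y. (1 / real n) * (\<Sum>i=1..n. f i y)) has_derivative
         (\<lambda>u. (1 / real n) * (\<Sum>i=1..n. inner (grad d (f i) x) u))) (at x within eucl d)"
    by (intro has_derivative_mult_right has_derivative_sum grad_works(2)[OF x diff]) auto
  then show ?thesis
    by (simp add: mean_fun_def[abs_def] inner_sum_left)
qed

lemma grad_mean_fun:
  assumes x: "x \<in> eucl d" and diff: "\<And>i. i \<in> {1..n} \<Longrightarrow> f i differentiable (at x within eucl d)"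
  shows "grad d (mean_fun n f) x = (1 / real n) *\<^sub>R (\<Sum>i=1..n. grad d (f i) x)"
  by (rule grad_eqI[OF x _ has_derivative_mean_fun[OF x diff]])
     (auto intro!: eucl_scaleR eucl_sum grad_works(1)[OF x diff])

text \<open>The quadratic upper bound of a smooth function, from the values of the gradient on the convex
  set only.\<close>

lemma descent_lemma:
  fixes h :: "fseq \<Rightarrow> real"
  assumes X: "X \<subseteq> eucl d" "convex X"
    and diff: "\<And>z. z \<in> X \<Longrightarrow> h differentiable (at z within eucl d)"
    and smooth: "grad_smooth_on d X M h"
    and xy: "x \<in> X" "y \<in> X"
  shows "h y \<le> h x + inner (grad d h x) (y - x) + M / 2 * (norm (y - x))\<^sup>2"
proof -
  let ?u = "y - x"
  define \<phi> where "\<phi> t = h (x + t *\<^sub>R ?u) - t * inner (grad d h x) ?u - M / 2 * t\<^sup>2 * (norm ?u)\<^sup>2" for t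
  have u: "x \<in> eucl d" "?u \<in> eucl d" using X xy by (auto intro: eucl_diff)
  have "\<phi> 1 \<le> \<phi> 0"
  proof (rule DERIV_nonpos_imp_nonincreasing[where f = \<phi>])
    fix t :: real assume t: "0 \<le> t" "t \<le> 1"
    let ?z = "x + t *\<^sub>R ?u"
    have "?z = (1 - t) *\<^sub>R x + t *\<^sub>R y" by (simp add: algebra_simps)
    then have z: "?z \<in> X"
      using X(2) xy t by (simp add: convex_def)
    let ?D = "inner (grad d h ?z) ?u - inner (grad d h x) ?u - M * t * (norm ?u)\<^sup>2"
    have line: "((\<lambda>t. h (x + t *\<^sub>R ?u)) has_real_derivative inner (grad d h ?z) ?u) (at t)"
      using grad_works(2)[OF _ diff[OF z]] z X u by (intro has_derivative_along_line) auto
    have "(\<phi> has_real_derivative ?D) (at t)"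
      unfolding \<phi>_def by (auto intro!: derivative_eq_intros line)
    moreover have "?D \<le> 0"
    proof -
      have "inner (grad d h ?z) ?u - inner (grad d h x) ?u = inner (grad d h ?z - grad d h x) ?u"
        by (simp add: inner_diff_left)
      also have "\<dots> \<le> norm (grad d h ?z - grad d h x) * norm ?u" by (rule norm_cauchy_schwarz)
      also have "\<dots> \<le> (M * norm (?z - x)) * norm ?u"
        using smooth[unfolded grad_smooth_on_def, rule_format, OF z xy(1)]
        by (rule mult_right_mono) simp
      also have "\<dots> = M * t * (norm ?u)\<^sup>2" using t by (simp add: power2_eq_square)
      finally show ?thesis by simp
    qed
    ultimately show "\<exists>y. (\<phi> has_real_derivative y) (at t) \<and> y \<le> 0" by blast
  qed simp
  then show ?thesis by (simp add: \<phi>_def)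
qed


section \<open>Expectations over finitely supported draws\<close>

lemma expectation_mono_finite:
  fixes F G :: "'a \<Rightarrow> real"
  assumes "finite (set_pmf q)" "\<And>x. x \<in> set_pmf q \<Longrightarrow> F x \<le> G x"
  shows "measure_pmf.expectation q F \<le> measure_pmf.expectation q G"
  using assms by (intro integral_mono_AE integrable_measure_pmf_finite) (auto simp: AE_measure_pmf_iff)

lemma expectation_add_finite:
  fixes F G :: "'a \<Rightarrow> real"
  assumes "finite (set_pmf q)"
  shows "measure_pmf.expectation q (\<lambda>x. F x + G x)
    = measure_pmf.expectation q F + measure_pmf.expectation q G"
  using assms by (intro Bochner_Integration.integral_add integrable_measure_pmf_finite)

lemma expectation_cong:
  assumes "\<And>x. x \<in> set_pmf q \<Longrightarrow> F x = G x"
  shows "measure_pmf.expectation q F = measure_pmf.expectation q G"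
  using assms by (intro integral_cong_AE) (auto simp: AE_measure_pmf_iff)

lemma expectation_bind_finite:
  fixes F :: "'b \<Rightarrow> real"
  assumes "finite (set_pmf q)" "\<And>x. x \<in> set_pmf q \<Longrightarrow> finite (set_pmf (r x))"
  shows "measure_pmf.expectation (bind_pmf q r) F
    = measure_pmf.expectation q (\<lambda>x. measure_pmf.expectation (r x) F)"
proof -
  have "measure_pmf.expectation (bind_pmf q r) F
      = (\<Sum>a\<in>set_pmf q. pmf q a *\<^sub>R measure_pmf.expectation (r a) F)"
    by (rule pmf_expectation_bind) (use assms in auto)
  also have "\<dots> = measure_pmf.expectation q (\<lambda>x. measure_pmf.expectation (r x) F)"
    by (subst integral_measure_pmf[OF assms(1)]) auto
  finally show ?thesis .
qed

lemma finite_set_replicate_pmf: "finite (set_pmf q) \<Longrightarrow> finite (set_pmf (replicate_pmf k q))"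
  by (induction k) (auto simp: set_bind_pmf)

lemma length_in_replicate_pmf: "xs \<in> set_pmf (replicate_pmf k q) \<Longrightarrow> length xs = k"
  by (simp add: set_replicate_pmf)

lemma expectation_replicate_Suc:
  fixes F :: "'a list \<Rightarrow> real"
  assumes fin: "finite (set_pmf q)"
  shows "measure_pmf.expectation (replicate_pmf (Suc k) q) F
    = measure_pmf.expectation q (\<lambda>x. measure_pmf.expectation (replicate_pmf k q) (\<lambda>xs. F (x # xs)))"
    and "measure_pmf.expectation (replicate_pmf (Suc k) q) F
    = measure_pmf.expectation (replicate_pmf k q) (\<lambda>xs. measure_pmf.expectation q (\<lambda>x. F (x # xs)))"
proof -
  note [simp] = finite_set_replicate_pmf[OF fin] fin
  show "measure_pmf.expectation (replicate_pmf (Suc k) q) F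
    = measure_pmf.expectation q (\<lambda>x. measure_pmf.expectation (replicate_pmf k q) (\<lambda>xs. F (x # xs)))"
    by (simp add: expectation_bind_finite)
  have "replicate_pmf (Suc k) q
      = bind_pmf (replicate_pmf k q) (\<lambda>xs. bind_pmf q (\<lambda>x. return_pmf (x # xs)))"
    unfolding replicate_pmf.simps by (rule bind_commute_pmf)
  then show "measure_pmf.expectation (replicate_pmf (Suc k) q) F
    = measure_pmf.expectation (replicate_pmf k q) (\<lambda>xs. measure_pmf.expectation q (\<lambda>x. F (x # xs)))"
    by (simp add: expectation_bind_finite del: replicate_pmf.simps)
qed

lemma expectation_pair_bernoulli:
  fixes F :: "'a \<times> bool \<Rightarrow> real"
  assumes "finite (set_pmf q)" "0 \<le> p" "p \<le> 1"
  shows "measure_pmf.expectation (pair_pmf q (bernoulli_pmf p)) F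
    = p * measure_pmf.expectation q (\<lambda>x. F (x, True))
      + (1 - p) * measure_pmf.expectation q (\<lambda>x. F (x, False))"
proof -
  have "measure_pmf.expectation (pair_pmf q (bernoulli_pmf p)) F
      = measure_pmf.expectation q (\<lambda>x. p * F (x, True) + (1 - p) * F (x, False))"
    using assms by (simp add: pair_pmf_def expectation_bind_finite mult.commute)
  then show ?thesis
    using assms by (simp add: expectation_add_finite)
qed

text \<open>Independent centred draws are orthogonal in mean square. Centring is expressed through inner
  products with fixed vectors, so no vector-valued integral is involved.\<close>

lemma expectation_norm_centred_sum:
  fixes u :: "'a \<Rightarrow> 'b::real_inner"
  assumes fin: "finite (set_pmf q)"
    and centred: "\<And>w. measure_pmf.expectation q (\<lambda>i. inner w (u i)) = 0"
  shows "measure_pmf.expectation (replicate_pmf m q) (\<lambda>S. (norm (e + c *\<^sub>R (\<Sum>i\<leftarrow>S. u i)))\<^sup>2)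
    = (norm e)\<^sup>2 + real m * c\<^sup>2 * measure_pmf.expectation q (\<lambda>i. (norm (u i))\<^sup>2)"
proof (induction m arbitrary: e)
  case (Suc m)
  let ?V = "measure_pmf.expectation q (\<lambda>i. (norm (u i))\<^sup>2)"
  have "measure_pmf.expectation (replicate_pmf (Suc m) q) (\<lambda>S. (norm (e + c *\<^sub>R (\<Sum>i\<leftarrow>S. u i)))\<^sup>2)
      = measure_pmf.expectation q (\<lambda>i. (norm (e + c *\<^sub>R u i))\<^sup>2 + real m * c\<^sup>2 * ?V)"
    by (simp add: expectation_replicate_Suc(1)[OF fin] scaleR_add_right add.assoc[symmetric] Suc
        del: replicate_pmf.simps)
  also have "\<dots> = measure_pmf.expectation q
      (\<lambda>i. ((norm e)\<^sup>2 + 2 * c * inner e (u i)) + (c\<^sup>2 * (norm (u i))\<^sup>2 + real m * c\<^sup>2 * ?V))"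
  proof (intro expectation_cong)
    fix i
    have "(norm (e + c *\<^sub>R u i))\<^sup>2 = (norm e)\<^sup>2 + 2 * c * inner e (u i) + c\<^sup>2 * (norm (u i))\<^sup>2"
      unfolding power2_norm_eq_inner power2_eq_square[of c]
      by (simp add: inner_add_left inner_add_right inner_commute[of "u i" e] distrib_left)
    then show "(norm (e + c *\<^sub>R u i))\<^sup>2 + real m * c\<^sup>2 * ?V
        = ((norm e)\<^sup>2 + 2 * c * inner e (u i)) + (c\<^sup>2 * (norm (u i))\<^sup>2 + real m * c\<^sup>2 * ?V)"
      by simp
  qed
  also have "\<dots> = (norm e)\<^sup>2 + real (Suc m) * c\<^sup>2 * ?V"
    by (simp add: expectation_add_finite[OF fin] centred distrib_right)
  finally show ?case .
qed simp

lemma sum_norm_centred_le: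
  fixes v :: "nat \<Rightarrow> 'b::real_inner"
  assumes m: "m = (1 / real n) *\<^sub>R (\<Sum>i=1..n. v i)"
  shows "(\<Sum>i=1..n. (norm (v i - m))\<^sup>2) \<le> (\<Sum>i=1..n. (norm (v i))\<^sup>2)"
proof (cases "n = 0")
  case False
  then have s: "(\<Sum>i=1..n. v i) = real n *\<^sub>R m" by (simp add: m)
  have "(\<Sum>i=1..n. (norm (v i - m))\<^sup>2)
      = (\<Sum>i=1..n. (norm (v i))\<^sup>2 - 2 * inner (v i) m + (norm m)\<^sup>2)"
    by (intro sum.cong refl)
       (simp add: power2_norm_eq_inner inner_diff_left inner_diff_right inner_commute)
  also have "\<dots> = (\<Sum>i=1..n. (norm (v i))\<^sup>2) - 2 * inner (\<Sum>i=1..n. v i) m + real n * (norm m)\<^sup>2"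
    by (simp add: sum.distrib sum_subtractf inner_sum_left sum_distrib_left)
  also have "\<dots> = (\<Sum>i=1..n. (norm (v i))\<^sup>2) - real n * (norm m)\<^sup>2"
    unfolding s by (simp add: power2_norm_eq_inner)
  finally show ?thesis by simp
qed simp

lemma expectation_minibatch:
  fixes v :: "nat \<Rightarrow> 'b::real_inner"
  assumes b: "1 \<le> b" and n: "1 \<le> n" and m: "m = (1 / real n) *\<^sub>R (\<Sum>i=1..n. v i)"
  shows "measure_pmf.expectation (replicate_pmf b (pmf_of_set {1..n}))
      (\<lambda>S. (norm (e + (1 / real b) *\<^sub>R (\<Sum>i\<leftarrow>S. v i) - m))\<^sup>2)
    \<le> (norm e)\<^sup>2 + 1 / real b * ((1 / real n) * (\<Sum>i=1..n. (norm (v i))\<^sup>2))"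
proof -
  let ?q = "pmf_of_set {1..n}"
  have q: "finite (set_pmf ?q)" using n by simp
  have E: "measure_pmf.expectation ?q F = (1 / real n) * (\<Sum>i=1..n. F i)" for F :: "nat \<Rightarrow> real"
    using n by (subst integral_pmf_of_set) auto
  have s: "(\<Sum>i=1..n. v i) = real n *\<^sub>R m" using n by (simp add: m)
  have centred: "measure_pmf.expectation ?q (\<lambda>i. inner w (v i - m)) = 0" for w
    by (simp only: E inner_diff_right sum_subtractf inner_sum_right[symmetric] s)
       (simp add: inner_sum_right)
  have shift: "(\<Sum>i\<leftarrow>S. v i - m) = (\<Sum>i\<leftarrow>S. v i) - real (length S) *\<^sub>R m" for S
    by (induction S) (simp_all add: algebra_simps)
  have "measure_pmf.expectation (replicate_pmf b ?q)
      (\<lambda>S. (norm (e + (1 / real b) *\<^sub>R (\<Sum>i\<leftarrow>S. v i) - m))\<^sup>2)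
    = measure_pmf.expectation (replicate_pmf b ?q)
      (\<lambda>S. (norm (e + (1 / real b) *\<^sub>R (\<Sum>i\<leftarrow>S. v i - m)))\<^sup>2)"
    using b by (intro expectation_cong) (auto dest!: length_in_replicate_pmf simp: shift scaleR_diff_right
        add_diff_eq)
  also have "\<dots> = (norm e)\<^sup>2 + real b * (1 / real b)\<^sup>2 * ((1 / real n) * (\<Sum>i=1..n. (norm (v i - m))\<^sup>2))"
    by (simp only: expectation_norm_centred_sum[OF q centred] E)
  also have "\<dots> = (norm e)\<^sup>2 + 1 / real b * ((1 / real n) * (\<Sum>i=1..n. (norm (v i - m))\<^sup>2))"
    using b by (simp add: power2_eq_square)
  also have "\<dots> \<le> (norm e)\<^sup>2 + 1 / real b * ((1 / real n) * (\<Sum>i=1..n. (norm (v i))\<^sup>2))"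
    by (intro add_left_mono mult_left_mono sum_norm_centred_le m) auto
  finally show ?thesis .
qed

section \<open>One step of Sarah Frank-Wolfe\<close>

lemma set_pmf_draw_finite: "1 \<le> n \<Longrightarrow> finite (set_pmf (draw_pmf n b p))"
  by (auto simp: draw_pmf_def intro!: finite_set_replicate_pmf finite_cartesian_product)

lemma set_pmf_history_finite: "1 \<le> n \<Longrightarrow> finite (set_pmf (history_pmf n b p k))"
  by (simp add: history_pmf_def finite_set_replicate_pmf set_pmf_draw_finite)

lemma length_history: "hs \<in> set_pmf (history_pmf n b p k) \<Longrightarrow> length hs = k"
  by (simp add: history_pmf_def length_in_replicate_pmf)

lemma history_SucE:
  assumes "hs \<in> set_pmf (history_pmf n b p (Suc k))"
  obtains \<omega> hs' where "hs = \<omega> # hs'" "hs' \<in> set_pmf (history_pmf n b p k)"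
  using assms by (auto simp: history_pmf_def)

lemma expectation_history_Suc:
  fixes F :: "draw list \<Rightarrow> real"
  assumes "1 \<le> n"
  shows "measure_pmf.expectation (history_pmf n b p (Suc k)) F
    = measure_pmf.expectation (history_pmf n b p k)
        (\<lambda>hs. measure_pmf.expectation (draw_pmf n b p) (\<lambda>\<omega>. F (\<omega> # hs)))"
  unfolding history_pmf_def by (rule expectation_replicate_Suc(2)[OF set_pmf_draw_finite[OF assms]])

lemma expectation_draw:
  fixes F :: "draw \<Rightarrow> real"
  assumes "1 \<le> n" "0 \<le> p" "p \<le> 1"
  shows "measure_pmf.expectation (draw_pmf n b p) F
    = p * measure_pmf.expectation (replicate_pmf b (pmf_of_set {1..n})) (\<lambda>S. F (S, True))
      + (1 - p) * measure_pmf.expectation (replicate_pmf b (pmf_of_set {1..n})) (\<lambda>S. F (S, False))"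
  unfolding draw_pmf_def
  by (rule expectation_pair_bernoulli) (use assms in \<open>auto intro!: finite_set_replicate_pmf\<close>)

text \<open>The optimization problem: a smooth convex average of n smooth functions over a convex set of
  diameter at most D, with a minimizer, a starting point and the batch size b.\<close>

locale finite_sum_problem =
  fixes d n b :: nat and X :: "fseq set" and f :: "nat \<Rightarrow> fseq \<Rightarrow> real"
    and L :: real and Li :: "nat \<Rightarrow> real" and D :: real and x0 xmin :: fseq
  assumes b: "1 \<le> b" and n: "1 \<le> n"
    and X: "X \<subseteq> eucl d" "convex X"
    and D: "D > 0" "\<And>x y. x \<in> X \<Longrightarrow> y \<in> X \<Longrightarrow> norm (x - y) \<le> D"
    and diff: "\<And>i. i \<in> {1..n} \<Longrightarrow> differentiable_near d X (f i)"
    and L: "L > 0" "grad_smooth_on d X L (mean_fun n f)"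
    and Li: "\<And>i. i \<in> {1..n} \<Longrightarrow> Li i > 0 \<and> grad_smooth_on d X (Li i) (f i)"
    and cvx: "grad_convex_on d X (mean_fun n f)"
    and xmin: "is_arg_min (mean_fun n f) (\<lambda>x. x \<in> X) xmin"
    and x0: "x0 \<in> X"
begin

abbreviation F where "F \<equiv> mean_fun n f"
abbreviation gradF where "gradF \<equiv> grad d F"

text \<open>The square of the quadratic mean of the constants of the summands.\<close>

definition Lsq :: real where "Lsq = (1 / real n) * (\<Sum>i=1..n. (Li i)\<^sup>2)"

lemma summand_differentiable:
  assumes "x \<in> X" "i \<in> {1..n}"
  shows "f i differentiable (at x within eucl d)"
  using diff[OF assms(2)] assms(1) X by (auto simp: differentiable_near_def)

lemma F_differentiable: "x \<in> X \<Longrightarrow> F differentiable (at x within eucl d)"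
  using has_derivative_mean_fun[of x d n f] summand_differentiable X
  by (auto simp: differentiable_def)

lemma gradF_eq: "x \<in> X \<Longrightarrow> gradF x = (1 / real n) *\<^sub>R (\<Sum>i=1..n. grad d (f i) x)"
  by (rule grad_mean_fun) (use X summand_differentiable in auto)

lemma xmin_in: "xmin \<in> X"
  using xmin by (simp add: is_arg_min_def)

lemma gap_nonneg: "x \<in> X \<Longrightarrow> F x - F xmin \<ge> 0"
  using xmin by (force simp: is_arg_min_def)

lemma Lsq_pos: "Lsq > 0"
  unfolding Lsq_def using n Li by (intro mult_pos_pos sum_pos) (auto simp: less_imp_neq[symmetric] dest: Li)

lemma frank_wolfe_point_in:
  assumes "x \<in> X" "s \<in> X" "0 \<le> \<gamma>" "\<gamma> \<le> 1"
  shows "x + \<gamma> *\<^sub>R (s - x) \<in> X"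
proof -
  have "x + \<gamma> *\<^sub>R (s - x) = (1 - \<gamma>) *\<^sub>R x + \<gamma> *\<^sub>R s" by (simp add: algebra_simps)
  then show ?thesis using X(2) assms by (simp add: convex_def)
qed

lemma frank_wolfe_step_le:
  assumes "x \<in> X" "s \<in> X" "0 \<le> \<gamma>"
  shows "norm (x + \<gamma> *\<^sub>R (s - x) - x) \<le> \<gamma> * D"
  using assms D(2)[of s x] by (auto intro: mult_left_mono)

text \<open>Since s minimizes the linear form of g rather than of the gradient, the step pays for the
  gradient error, weighted by the distance of s from the minimizer.\<close>

lemma frank_wolfe_gap:
  assumes x: "x \<in> X" and s: "is_arg_min (\<lambda>s. inner g s) (\<lambda>s. s \<in> X) s" and \<gamma>: "0 \<le> \<gamma>" "\<gamma> \<le> 1"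
  shows "F (x + \<gamma> *\<^sub>R (s - x)) - F xmin
    \<le> (1 - \<gamma>) * (F x - F xmin) + \<gamma> * D * norm (g - gradF x) + L / 2 * (\<gamma> * D)\<^sup>2"
proof -
  let ?x' = "x + \<gamma> *\<^sub>R (s - x)"
  have sX: "s \<in> X" and s_min: "inner g s \<le> inner g xmin"
    using s xmin_in by (force simp: is_arg_min_def)+
  have "F ?x' \<le> F x + inner (gradF x) (?x' - x) + L / 2 * (norm (?x' - x))\<^sup>2"
    by (rule descent_lemma[OF X F_differentiable L(2) x frank_wolfe_point_in[OF x sX \<gamma>]])
  moreover have "L / 2 * (norm (?x' - x))\<^sup>2 \<le> L / 2 * (\<gamma> * D)\<^sup>2"
    using frank_wolfe_step_le[OF x sX \<gamma>(1)] L(1) by (intro mult_left_mono power_mono) auto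
  moreover have "inner (gradF x) (?x' - x) = \<gamma> * inner (gradF x) (s - x)" by simp
  moreover have "inner (gradF x) (s - x) \<le> - (F x - F xmin) + D * norm (g - gradF x)"
  proof -
    have "inner (gradF x) (s - x)
        = inner (gradF x) (xmin - x) + inner g (s - xmin) + inner (g - gradF x) (xmin - s)"
      by (simp add: inner_diff_left inner_diff_right)
    moreover have "inner (gradF x) (xmin - x) \<le> - (F x - F xmin)"
      using cvx x xmin_in by (force simp: grad_convex_on_def)
    moreover have "inner g (s - xmin) \<le> 0" using s_min by (simp add: inner_diff_right)
    moreover have "inner (g - gradF x) (xmin - s) \<le> D * norm (g - gradF x)"
    proof -
      have "inner (g - gradF x) (xmin - s) \<le> norm (g - gradF x) * norm (xmin - s)"
        by (rule norm_cauchy_schwarz)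
      also have "\<dots> \<le> norm (g - gradF x) * D"
        using D(2)[OF xmin_in sX] by (rule mult_left_mono) simp
      finally show ?thesis by (simp add: mult.commute)
    qed
    ultimately show ?thesis by linarith
  qed
  then have "\<gamma> * inner (gradF x) (s - x) \<le> \<gamma> * (- (F x - F xmin) + D * norm (g - gradF x))"
    using \<gamma>(1) by (rule mult_left_mono)
  ultimately show ?thesis by (simp add: algebra_simps)
qed

text \<open>Without a restart, the deviation of the batch mean from its expectation is orthogonal in mean
  square to the old error, and its variance is at most the mean square of the gradient differences
  divided by the batch size.\<close>

lemma recursive_estimator_error:
  assumes x: "x \<in> X" and x': "x' \<in> X" and dist: "norm (x' - x) \<le> r"
  shows "measure_pmf.expectation (replicate_pmf b (pmf_of_set {1..n}))
      (\<lambda>S. (norm (g + (1 / real b) *\<^sub>R (\<Sum>i\<leftarrow>S. (grad d (f i) x' - grad d (f i) x)) - gradF x'))\<^sup>2)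
    \<le> (norm (g - gradF x))\<^sup>2 + Lsq * r\<^sup>2 / real b"
proof -
  define v where "v i = grad d (f i) x' - grad d (f i) x" for i
  have m: "gradF x' - gradF x = (1 / real n) *\<^sub>R (\<Sum>i=1..n. v i)"
    by (simp add: gradF_eq x x' v_def sum_subtractf scaleR_diff_right)
  have v_le: "(norm (v i))\<^sup>2 \<le> (Li i)\<^sup>2 * r\<^sup>2" if i: "i \<in> {1..n}" for i
  proof -
    have "norm (v i) \<le> Li i * norm (x' - x)"
      using Li[OF i] x x' by (auto simp: grad_smooth_on_def v_def)
    also have "\<dots> \<le> Li i * r" using dist Li[OF i] by (intro mult_left_mono) auto
    finally have "(norm (v i))\<^sup>2 \<le> (Li i * r)\<^sup>2" by (rule power_mono) simp
    then show ?thesis by (simp add: power_mult_distrib)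
  qed
  have "(\<lambda>S. g + (1 / real b) *\<^sub>R (\<Sum>i\<leftarrow>S. v i) - gradF x')
      = (\<lambda>S. (g - gradF x) + (1 / real b) *\<^sub>R (\<Sum>i\<leftarrow>S. v i) - (gradF x' - gradF x))"
    by (simp add: algebra_simps)
  then have "measure_pmf.expectation (replicate_pmf b (pmf_of_set {1..n}))
      (\<lambda>S. (norm (g + (1 / real b) *\<^sub>R (\<Sum>i\<leftarrow>S. v i) - gradF x'))\<^sup>2)
    \<le> (norm (g - gradF x))\<^sup>2 + 1 / real b * ((1 / real n) * (\<Sum>i=1..n. (norm (v i))\<^sup>2))"
    using expectation_minibatch[OF b n m, of "g - gradF x"] by (simp add: fun_eq_iff)
  also have "\<dots> \<le> (norm (g - gradF x))\<^sup>2 + 1 / real b * ((1 / real n) * (\<Sum>i=1..n. (Li i)\<^sup>2 * r\<^sup>2))"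
    by (intro add_left_mono mult_left_mono sum_mono v_le) auto
  also have "\<dots> = (norm (g - gradF x))\<^sup>2 + Lsq * r\<^sup>2 / real b"
    by (simp add: Lsq_def sum_distrib_right[symmetric])
  finally show ?thesis by (simp add: v_def)
qed

end

text \<open>A run of the method for K iterations, with step sizes at most half the restart probability.\<close>

locale sarah_run = finite_sum_problem +
  fixes p :: real and \<eta> :: "nat \<Rightarrow> real" and K :: nat and lmo :: "draw list \<Rightarrow> fseq"
  assumes p: "0 < p" "p \<le> 1"
    and \<eta>: "\<And>k. k < K \<Longrightarrow> 0 \<le> \<eta> k \<and> \<eta> k \<le> p / 2"
    and lmo: "valid_lmo d n b p X f \<eta> x0 K lmo"
begin

abbreviation run where "run \<equiv> sarah_fw d n b f \<eta> x0 lmo"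

lemma lmo_arg_min:
  "hs \<in> set_pmf (history_pmf n b p k) \<Longrightarrow> k < K
    \<Longrightarrow> is_arg_min (\<lambda>s. inner (snd (run hs)) s) (\<lambda>s. s \<in> X) (lmo hs)"
  using lmo by (simp add: valid_lmo_def)

lemma fst_run_Cons:
  "fst (run (\<omega> # hs)) = fst (run hs) + \<eta> (length hs) *\<^sub>R (lmo hs - fst (run hs))"
  by (simp add: split_beta Let_def)

lemma iterate_in:
  "hs \<in> set_pmf (history_pmf n b p k) \<Longrightarrow> k \<le> K \<Longrightarrow> fst (run hs) \<in> X"
proof (induction k arbitrary: hs)
  case 0
  then show ?case using x0 by (simp add: history_pmf_def)
next
  case (Suc k)
  obtain \<omega> hs' where hs: "hs = \<omega> # hs'" "hs' \<in> set_pmf (history_pmf n b p k)"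
    using Suc.prems(1) by (rule history_SucE)
  have "lmo hs' \<in> X" using lmo_arg_min[OF hs(2)] Suc.prems(2) by (simp add: is_arg_min_def)
  moreover have "0 \<le> \<eta> k" "\<eta> k \<le> 1" using \<eta>[of k] Suc.prems(2) p by auto
  ultimately show ?case
    using Suc.IH[OF hs(2)] Suc.prems(2) length_history[OF hs(2)]
    unfolding hs(1) fst_run_Cons by (auto intro: frank_wolfe_point_in)
qed

text \<open>The Lyapunov function: optimality gap plus weighted squared error of the gradient estimate.\<close>

definition lyapunov :: "real \<Rightarrow> draw list \<Rightarrow> real" where
  "lyapunov c hs = F (fst (run hs)) - F xmin + c * (norm (snd (run hs) - gradF (fst (run hs))))\<^sup>2"

lemma lyapunov_step:
  assumes c: "0 < c" and hs: "hs \<in> set_pmf (history_pmf n b p k)" and k: "k < K"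
  shows "measure_pmf.expectation (draw_pmf n b p) (\<lambda>\<omega>. lyapunov c (\<omega> # hs))
    \<le> (1 - \<eta> k) * lyapunov c hs
      + (\<eta> k)\<^sup>2 * (D\<^sup>2 * (L / 2 + c * (1 - p) * Lsq / real b + 1 / (2 * c * p)))"
proof -
  define x where "x = fst (run hs)"
  define g where "g = snd (run hs)"
  define x' where "x' = x + \<eta> k *\<^sub>R (lmo hs - x)"
  define g' where "g' S = g + (1 / real b) *\<^sub>R (\<Sum>i\<leftarrow>S. (grad d (f i) x' - grad d (f i) x))" for S
  let ?\<delta> = "norm (g - gradF x)"
  let ?r = "\<eta> k * D"
  let ?R = "replicate_pmf b (pmf_of_set {1..n})"
  have x: "x \<in> X" unfolding x_def using iterate_in[OF hs] k by simp
  have s: "is_arg_min (\<lambda>s. inner g s) (\<lambda>s. s \<in> X) (lmo hs)"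
    unfolding g_def using lmo_arg_min[OF hs k] .
  then have sX: "lmo hs \<in> X" by (simp add: is_arg_min_def)
  have \<eta>k: "0 \<le> \<eta> k" "\<eta> k \<le> 1" "\<eta> k \<le> p / 2" using \<eta>[OF k] p by auto
  have run: "run ((S, coin) # hs) = (x', if coin then gradF x' else g' S)" for S coin
    by (simp add: split_beta Let_def x_def g_def x'_def g'_def length_history[OF hs])
  have R: "finite (set_pmf ?R)" using n by (auto intro!: finite_set_replicate_pmf)
  have "measure_pmf.expectation (draw_pmf n b p) (\<lambda>\<omega>. lyapunov c (\<omega> # hs))
      = p * (F x' - F xmin) + (1 - p) * (F x' - F xmin
          + c * measure_pmf.expectation ?R (\<lambda>S. (norm (g' S - gradF x'))\<^sup>2))"
    using p n
    by (simp add: expectation_draw lyapunov_def run expectation_add_finite[OF R]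
        del: sarah_fw.simps One_nat_def)
  also have "\<dots> = F x' - F xmin
      + c * (1 - p) * measure_pmf.expectation ?R (\<lambda>S. (norm (g' S - gradF x'))\<^sup>2)"
    by (simp add: algebra_simps)
  also have "\<dots> \<le> ((1 - \<eta> k) * (F x - F xmin) + ?r * ?\<delta> + L / 2 * ?r\<^sup>2)
      + c * (1 - p) * (?\<delta>\<^sup>2 + Lsq * ?r\<^sup>2 / real b)"
  proof (intro add_mono mult_left_mono)
    show "F x' - F xmin \<le> (1 - \<eta> k) * (F x - F xmin) + ?r * ?\<delta> + L / 2 * ?r\<^sup>2"
      unfolding x'_def using frank_wolfe_gap[OF x s \<eta>k(1,2)] .
    show "measure_pmf.expectation ?R (\<lambda>S. (norm (g' S - gradF x'))\<^sup>2)
        \<le> ?\<delta>\<^sup>2 + Lsq * ?r\<^sup>2 / real b"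
      unfolding g'_def
      by (rule recursive_estimator_error[OF x])
         (use frank_wolfe_point_in[OF x sX \<eta>k(1,2)] frank_wolfe_step_le[OF x sX \<eta>k(1)]
          in \<open>auto simp: x'_def\<close>)
  qed (use c p in auto)
  also have "\<dots> \<le> (1 - \<eta> k) * (F x - F xmin + c * ?\<delta>\<^sup>2)
      + ?r\<^sup>2 * (L / 2 + c * (1 - p) * Lsq / real b + 1 / (2 * c * p))"
  proof -
    have young: "?r * ?\<delta> \<le> c * p / 2 * ?\<delta>\<^sup>2 + ?r\<^sup>2 * (1 / (2 * c * p))"
    proof -
      have "0 \<le> (c * p * ?\<delta> - ?r)\<^sup>2 / (2 * c * p)" using c p by simp
      also have "\<dots> = c * p / 2 * ?\<delta>\<^sup>2 - ?r * ?\<delta> + ?r\<^sup>2 * (1 / (2 * c * p))"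
        using c p by (simp add: power2_diff field_simps power2_eq_square)
      finally show ?thesis by simp
    qed
    have "\<eta> k * (c * ?\<delta>\<^sup>2) \<le> p / 2 * (c * ?\<delta>\<^sup>2)"
      using \<eta>k(3) c by (intro mult_right_mono) auto
    with young show ?thesis by (simp add: algebra_simps)
  qed
  finally show ?thesis
    by (simp add: lyapunov_def x_def g_def power_mult_distrib mult.assoc)
qed

lemma expected_lyapunov_step:
  assumes c: "0 < c" and k: "k < K"
  shows "measure_pmf.expectation (history_pmf n b p (Suc k)) (lyapunov c)
    \<le> (1 - \<eta> k) * measure_pmf.expectation (history_pmf n b p k) (lyapunov c)
      + (\<eta> k)\<^sup>2 * (D\<^sup>2 * (L / 2 + c * (1 - p) * Lsq / real b + 1 / (2 * c * p)))"
    (is "_ \<le> _ + ?B")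
proof -
  note fin = set_pmf_history_finite[OF n]
  have "measure_pmf.expectation (history_pmf n b p (Suc k)) (lyapunov c)
      \<le> measure_pmf.expectation (history_pmf n b p k) (\<lambda>hs. (1 - \<eta> k) * lyapunov c hs + ?B)"
    unfolding expectation_history_Suc[OF n]
    by (rule expectation_mono_finite[OF fin]) (rule lyapunov_step[OF c _ k])
  also have "\<dots> = (1 - \<eta> k) * measure_pmf.expectation (history_pmf n b p k) (lyapunov c) + ?B"
    by (simp add: expectation_add_finite[OF fin])
  finally show ?thesis .
qed

lemma expected_lyapunov_0:
  "measure_pmf.expectation (history_pmf n b p 0) (lyapunov c) = F x0 - F xmin"
  by (simp add: history_pmf_def lyapunov_def)

lemma expected_gap_le_lyapunov:
  assumes "0 < c"
  shows "measure_pmf.expectation (history_pmf n b p k) (\<lambda>hs. F (fst (run hs)) - F xmin)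
    \<le> measure_pmf.expectation (history_pmf n b p k) (lyapunov c)"
  using assms by (intro expectation_mono_finite set_pmf_history_finite[OF n]) (simp add: lyapunov_def)

end


section \<open>The two-phase step size\<close>

lemma step_size_first:
  assumes "2 / p < real (2 * N)" "k < N"
  shows "step_size p (2 * N) k = p / 2"
  using assms by (simp add: step_size_def)

lemma step_size_second:
  assumes "2 / p < real (2 * N)"
  shows "step_size p (2 * N) (N + j) = 2 / (4 / p + real j)"
  using assms by (simp add: step_size_def)

lemma step_size_bounds:
  assumes "0 < p" "2 / p < real (2 * N)"
  shows "0 \<le> step_size p (2 * N) k \<and> step_size p (2 * N) k \<le> p / 2"
proof (cases "k < N")
  case True
  then show ?thesis using assms by (simp add: step_size_first)
next
  case False
  then obtain j where k: "k = N + j" using le_Suc_ex not_less by blast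
  have "2 / (4 / p + real j) \<le> 2 / (4 / p)"
    using assms(1) by (intro divide_left_mono mult_pos_pos) (auto intro: add_pos_nonneg)
  then show ?thesis using assms unfolding k step_size_second[OF assms(2)] by simp
qed

text \<open>The first phase contracts the initial value geometrically down to a noise floor of order p A;
  the second phase, with weights (a + j - 1) (a + j - 2) for a = 4 / p, removes the floor at rate
  1 / N.\<close>

lemma two_phase_recursion:
  fixes r :: "nat \<Rightarrow> real"
  assumes p: "0 < p" "p \<le> 2 / 3" and A: "0 \<le> A" and r0: "0 \<le> r 0" and N: "2 / p < real (2 * N)"
    and step: "\<And>k. k < 2 * N \<Longrightarrow>
      r (Suc k) \<le> (1 - step_size p (2 * N) k) * r k + (step_size p (2 * N) k)\<^sup>2 * A"
  shows "r (2 * N) \<le> 2 * (1 - p / 2) ^ N * r 0 + 8 * A / (4 / p + real N)"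
proof -
  define a where "a = 4 / p"
  have a: "6 \<le> a" using p by (simp add: a_def field_simps)
  have pa: "p = 4 / a" using p by (simp add: a_def)
  define T where "T = a + real N"
  define q where "q = (1 - p / 2) ^ N * r 0"
  have T: "6 \<le> T" "a \<le> T" using a by (auto simp: T_def)
  have q: "0 \<le> q" using p r0 by (simp add: q_def)
  \<comment> \<open>The noise level p A / 2 is the fixed point of the recursion with step size p / 2.\<close>
  have first: "k \<le> N \<Longrightarrow> r k \<le> (1 - p / 2) ^ k * r 0 + p / 2 * A" for k
  proof (induction k)
    case (Suc k)
    have "r (Suc k) \<le> (1 - p / 2) * r k + (p / 2)\<^sup>2 * A"
      using step[of k] Suc.prems by (simp add: step_size_first[OF N])
    also have "\<dots> \<le> (1 - p / 2) * ((1 - p / 2) ^ k * r 0 + p / 2 * A) + (p / 2)\<^sup>2 * A"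
      using Suc p by (intro add_right_mono mult_left_mono) auto
    also have "\<dots> = (1 - p / 2) ^ Suc k * r 0 + p / 2 * A"
      by (simp add: field_simps power2_eq_square)
    finally show ?case .
  qed (use p A in simp)
  have second: "j \<le> N \<Longrightarrow>
      (a + real j - 1) * (a + real j - 2) * r (N + j) \<le> (a - 1) * (a - 2) * r N + 4 * A * real j" for j
  proof (induction j)
    case (Suc j)
    define t where "t = a + real j"
    have t: "6 \<le> t" using a by (simp add: t_def)
    have "r (Suc (N + j)) \<le> (1 - 2 / t) * r (N + j) + (2 / t)\<^sup>2 * A"
      using step[of "N + j"] Suc.prems by (simp add: step_size_second[OF N] t_def a_def)
    then have "t * (t - 1) * r (Suc (N + j)) \<le> t * (t - 1) * ((1 - 2 / t) * r (N + j) + (2 / t)\<^sup>2 * A)"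
      using t by (intro mult_left_mono) auto
    also have "\<dots> = (t - 1) * (t - 2) * r (N + j) + 4 * A * ((t - 1) / t)"
      using t by (simp add: field_simps power2_eq_square)
    also have "\<dots> \<le> (t - 1) * (t - 2) * r (N + j) + 4 * A * 1"
      using t A by (intro add_left_mono mult_left_mono) auto
    also have "\<dots> \<le> (a - 1) * (a - 2) * r N + 4 * A * real (Suc j)"
      using Suc by (simp add: t_def algebra_simps)
    finally show ?case by (simp add: t_def algebra_simps)
  qed simp
  have W: "T\<^sup>2 / 2 \<le> (T - 1) * (T - 2)"
  proof -
    have "0 \<le> T * (T - 6)" using T by simp
    then show ?thesis by (simp add: algebra_simps power2_eq_square)
  qed
  have "(T - 1) * (T - 2) * r (2 * N) \<le> (a - 1) * (a - 2) * r N + 4 * A * real N"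
    using second[of N] by (simp add: T_def mult_2)
  also have "\<dots> \<le> (a - 1) * (a - 2) * (q + p / 2 * A) + 4 * A * real N"
    using first[of N] a by (intro add_right_mono mult_left_mono) (auto simp: q_def)
  also have "\<dots> \<le> a\<^sup>2 * (q + p / 2 * A) + 4 * A * real N"
    using q p A a by (intro add_right_mono mult_right_mono) (auto simp: algebra_simps power2_eq_square)
  also have "\<dots> = a\<^sup>2 * q + (2 * a * A + 4 * A * real N)"
    using a by (simp add: pa field_simps power2_eq_square)
  also have "\<dots> \<le> T\<^sup>2 * q + 4 * A * T"
    using a q A T by (intro add_mono mult_right_mono power_mono) (auto simp: T_def algebra_simps)
  also have "\<dots> = T\<^sup>2 / 2 * (2 * q + 8 * A / T)"
    using T by (simp add: field_simps power2_eq_square)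
  also have "\<dots> \<le> (T - 1) * (T - 2) * (2 * q + 8 * A / T)"
    using W q A T by (intro mult_right_mono) auto
  finally have "r (2 * N) \<le> 2 * q + 8 * A / T"
    using T by (subst (asm) mult_le_cancel_left_pos) auto
  then show ?thesis by (simp add: q_def T_def a_def mult.assoc)
qed


section \<open>Complexity\<close>

lemma expected_oracle_calls:
  assumes n: "1 \<le> n" and p: "0 \<le> p" "p \<le> 1"
  shows "measure_pmf.expectation (history_pmf n b p k) (\<lambda>hs. real (oracle_calls n hs))
    = real n + real k * (p * real n + (1 - p) * (2 * real b))"
proof (induction k)
  case (Suc k)
  have R: "finite (set_pmf (replicate_pmf b (pmf_of_set {1..n})))"
    using n by (auto intro!: finite_set_replicate_pmf)
  have len: "measure_pmf.expectation (replicate_pmf b (pmf_of_set {1..n})) (\<lambda>S. real (length S)) = real b"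
    using expectation_cong[of "replicate_pmf b (pmf_of_set {1..n})" "\<lambda>S. real (length S)" "\<lambda>_. real b"]
    by (simp add: length_in_replicate_pmf)
  have "measure_pmf.expectation (history_pmf n b p (Suc k)) (\<lambda>hs. real (oracle_calls n hs))
      = measure_pmf.expectation (history_pmf n b p k) (\<lambda>hs. p * (real (oracle_calls n hs) + real n)
          + (1 - p) * (real (oracle_calls n hs) + 2 * real b))"
    by (simp add: expectation_history_Suc[OF n] expectation_draw[OF n p] expectation_add_finite[OF R]
        len del: One_nat_def)
  also have "\<dots> = measure_pmf.expectation (history_pmf n b p k)
      (\<lambda>hs. real (oracle_calls n hs) + (p * real n + (1 - p) * (2 * real b)))"
    by (intro expectation_cong) (simp add: algebra_simps)
  also have "\<dots> = real n + real (Suc k) * (p * real n + (1 - p) * (2 * real b))"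
    by (simp add: expectation_add_finite[OF set_pmf_history_finite[OF n]] Suc distrib_right)
  finally show ?case .
qed (simp add: history_pmf_def)

text \<open>The convergence rate for an even number of iterations. The weight of the squared error in the
  Lyapunov function is the one that minimizes the noise constant.\<close>

lemma (in finite_sum_problem) sarah_convergence:
  assumes p_eq: "p = 2 * real b / (real n + 2 * real b)" and bn: "b \<le> n"
    and N: "2 / p < real (2 * N)"
    and lmo: "valid_lmo d n b p X f (step_size p (2 * N)) x0 (2 * N) lmo"
  shows "measure_pmf.expectation (history_pmf n b p (2 * N))
      (\<lambda>hs. F (fst (sarah_fw d n b f (step_size p (2 * N)) x0 lmo hs)) - F xmin)
    \<le> 2 * (1 - p / 2) ^ N * (F x0 - F xmin)
      + 8 * (D\<^sup>2 * (L / 2 + sqrt Lsq * sqrt (real n) / real b)) / (4 / p + real N)"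
proof -
  have p': "0 < p" "p \<le> 2 / 3" "p \<le> 1" using b n bn by (auto simp: p_eq field_simps)
  interpret sarah_run d n b X f L Li D x0 xmin p "step_size p (2 * N)" "2 * N" lmo
    by unfold_locales (use p' step_size_bounds[OF _ N] lmo in auto)
  define l where "l = sqrt Lsq"
  define m where "m = sqrt (real n)"
  have l: "0 < l" "Lsq = l * l" using Lsq_pos by (auto simp: l_def)
  have m: "0 < m" "real n = m * m" using n by (auto simp: m_def)
  define c where "c = (real n + 2 * real b) / (2 * m * l)"
  have c: "0 < c" using l m b by (simp add: c_def add_nonneg_pos)
  \<comment> \<open>At this weight the two error terms of the noise constant coincide.\<close>
  have half: "c * (1 - p) * Lsq / real b = l * m / (2 * real b)" "1 / (2 * c * p) = l * m / (2 * real b)"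
  proof -
    have s: "real n + 2 * real b > 0" using b by simp
    have "1 - p = real n / (real n + 2 * real b)" using s by (simp add: p_eq field_simps)
    then show "c * (1 - p) * Lsq / real b = l * m / (2 * real b)"
      using s l(1) m(1) b by (simp add: c_def l(2)) (simp add: m(2))
    have "c * p = real b / (m * l)" using s by (simp add: c_def p_eq)
    then show "1 / (2 * c * p) = l * m / (2 * real b)" by (simp add: mult.assoc)
  qed
  let ?A = "D\<^sup>2 * (L / 2 + c * (1 - p) * Lsq / real b + 1 / (2 * c * p))"
  have A: "?A = D\<^sup>2 * (L / 2 + l * m / real b)" unfolding half by simp
  have "measure_pmf.expectation (history_pmf n b p (2 * N)) (\<lambda>hs. F (fst (run hs)) - F xmin)
      \<le> measure_pmf.expectation (history_pmf n b p (2 * N)) (lyapunov c)"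
    by (rule expected_gap_le_lyapunov[OF c])
  also have "\<dots> \<le> 2 * (1 - p / 2) ^ N * measure_pmf.expectation (history_pmf n b p 0) (lyapunov c)
      + 8 * ?A / (4 / p + real N)"
  proof (rule two_phase_recursion[OF p'(1,2) _ _ N])
    show "0 \<le> ?A" unfolding A using L(1) l m by (intro mult_nonneg_nonneg) auto
    show "0 \<le> measure_pmf.expectation (history_pmf n b p 0) (lyapunov c)"
      unfolding expected_lyapunov_0 by (rule gap_nonneg[OF x0])
  qed (rule expected_lyapunov_step[OF c])
  finally show ?thesis unfolding A expected_lyapunov_0 l_def m_def .
qed

theorem corollary4p2:
  shows "\<exists>C::real. C > 0 \<and>
    (\<forall>(d::nat) (n::nat) (b::nat) (X::fseq set) (f::nat \<Rightarrow> fseq \<Rightarrow> real)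
       (L::real) (Li::nat \<Rightarrow> real) (D::real) (x0::fseq) (xmin::fseq).
      1 \<le> b \<and> b \<le> n \<and>
      X \<subseteq> eucl d \<and> X \<noteq> {} \<and> convex X \<and> compact X \<and>
      D > 0 \<and> (\<forall>x\<in>X. \<forall>y\<in>X. norm (x - y) \<le> D) \<and>
      (\<forall>i\<in>{1..n}. differentiable_near d X (f i)) \<and>
      L > 0 \<and> grad_smooth_on d X L (mean_fun n f) \<and>
      (\<forall>i\<in>{1..n}. Li i > 0 \<and> grad_smooth_on d X (Li i) (f i)) \<and>
      grad_convex_on d X (mean_fun n f) \<and>
      is_arg_min (mean_fun n f) (\<lambda>x. x \<in> X) xmin \<and>
      x0 \<in> X
      \<longrightarrow> (let p = 2 * real b / (real n + 2 * real b);
               Lt = sqrt ((1 / real n) * (\<Sum>i=1..n. (Li i)\<^sup>2))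
           in \<exists>\<epsilon>0>0. \<forall>\<epsilon>. 0 < \<epsilon> \<and> \<epsilon> \<le> \<epsilon>0 \<longrightarrow>
                (\<exists>K::nat.
                  (\<forall>lmo. valid_lmo d n b p X f (step_size p K) x0 K lmo \<longrightarrow>
                     measure_pmf.expectation (history_pmf n b p K)
                       (\<lambda>hs. mean_fun n f (fst (sarah_fw d n b f (step_size p K) x0 lmo hs))
                             - mean_fun n f xmin) \<le> \<epsilon>) \<and>
                  real K \<le> C * (real n / real b * ln (1 / \<epsilon>)
                               + (1 + Lt * sqrt (real n) / (real b * L)) * (L * D\<^sup>2 / \<epsilon>)) \<and>
                  measure_pmf.expectation (history_pmf n b p K) (\<lambda>hs. real (oracle_calls n hs))
                    \<le> C * (real n * ln (1 / \<epsilon>)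
                           + (real b + Lt * sqrt (real n) / L) * (L * D\<^sup>2 / \<epsilon>)))))"
proof (rule exI[of _ 129], rule conjI, simp, intro allI impI, unfold Let_def, elim conjE)
  fix d n b :: nat and X :: "fseq set" and f :: "nat \<Rightarrow> fseq \<Rightarrow> real"
    and L :: real and Li :: "nat \<Rightarrow> real" and D :: real and x0 xmin :: fseq
  assume *: "1 \<le> b" "b \<le> n" "X \<subseteq> eucl d" "convex X" "D > 0" "\<forall>x\<in>X. \<forall>y\<in>X. norm (x - y) \<le> D"
    "\<forall>i\<in>{1..n}. differentiable_near d X (f i)" "L > 0" "grad_smooth_on d X L (mean_fun n f)"
    "\<forall>i\<in>{1..n}. Li i > 0 \<and> grad_smooth_on d X (Li i) (f i)" "grad_convex_on d X (mean_fun n f)"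
    "is_arg_min (mean_fun n f) (\<lambda>x. x \<in> X) xmin" "x0 \<in> X"
  interpret finite_sum_problem d n b X f L Li D x0 xmin
    by unfold_locales (use * in auto)
  define p where "p = 2 * real b / (real n + 2 * real b)"
  define Lt where "Lt = sqrt ((1 / real n) * (\<Sum>i=1..n. (Li i)\<^sup>2))"
  have Lt_eq: "Lt = sqrt Lsq" by (simp only: Lt_def Lsq_def)
  have Lt: "0 < Lt" using Lsq_pos by (simp add: Lt_eq)
  have p: "0 < p" "p \<le> 1" using * n by (auto simp: p_def field_simps)
  define h0 where "h0 = F x0 - F xmin"
  have h0: "0 \<le> h0" unfolding h0_def by (rule gap_nonneg[OF x0])
  define A where "A = D\<^sup>2 * (L / 2 + Lt * sqrt (real n) / real b)"
  have A: "0 < A" unfolding A_def using L D Lt n by (intro mult_pos_pos add_pos_nonneg) auto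
  \<comment> \<open>The first bound gives ln (1 / \<epsilon>) \<ge> 1. The second absorbs the initial gap, whose factor
    after the first phase is at most \<epsilon>^2.\<close>
  define \<epsilon>0 where "\<epsilon>0 = min (exp (- 1)) (1 / (4 * (h0 + 1)))"
  have \<epsilon>0: "0 < \<epsilon>0" using h0 by (simp add: \<epsilon>0_def)
  have "\<exists>K. (\<forall>lmo. valid_lmo d n b p X f (step_size p K) x0 K lmo \<longrightarrow>
                measure_pmf.expectation (history_pmf n b p K)
                  (\<lambda>hs. F (fst (sarah_fw d n b f (step_size p K) x0 lmo hs)) - F xmin) \<le> \<epsilon>) \<and>
             real K \<le> 129 * (real n / real b * ln (1 / \<epsilon>)
               + (1 + Lt * sqrt (real n) / (real b * L)) * (L * D\<^sup>2 / \<epsilon>)) \<and>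
             measure_pmf.expectation (history_pmf n b p K) (\<lambda>hs. real (oracle_calls n hs))
               \<le> 129 * (real n * ln (1 / \<epsilon>) + (real b + Lt * sqrt (real n) / L) * (L * D\<^sup>2 / \<epsilon>))"
    if \<epsilon>: "0 < \<epsilon>" "\<epsilon> \<le> \<epsilon>0" for \<epsilon>
  proof -
    define l where "l = ln (1 / \<epsilon>)"
    have exp_l: "exp (- l) = \<epsilon>" using \<epsilon>(1) by (simp add: l_def ln_div)
    have l: "1 \<le> l"
    proof -
      have "exp (- l) \<le> exp (- 1)" using \<epsilon>(2) by (simp add: exp_l \<epsilon>0_def)
      then show ?thesis by simp
    qed
    have \<epsilon>h: "4 * \<epsilon> * h0 \<le> 1"
    proof -
      have "\<epsilon> * (4 * (h0 + 1)) \<le> 1" using \<epsilon>(2) h0 by (simp add: \<epsilon>0_def field_simps)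
      then show ?thesis using \<epsilon>(1) by (simp add: algebra_simps)
    qed
    \<comment> \<open>The first term makes the second phase long enough, the second term the first phase.\<close>
    define N where "N = nat \<lceil>16 * A / \<epsilon> + 4 / p * l\<rceil>"
    have pos: "0 < 16 * A / \<epsilon>" "0 < 4 / p * l" using A \<epsilon> p l by (auto intro!: divide_pos_pos mult_pos_pos)
    have N_lower: "16 * A / \<epsilon> \<le> real N" "4 / p * l \<le> real N"
      using pos unfolding N_def by linarith+
    have N_upper: "real N \<le> 16 * A / \<epsilon> + 4 / p * l + 1"
      using pos unfolding N_def by linarith
    have N: "2 / p < real (2 * N)"
    proof -
      have "2 / p < 4 / p * 1" using p by (simp add: field_simps)
      also have "\<dots> \<le> 4 / p * l" using l p by (intro mult_left_mono) auto
      finally show ?thesis using N_lower by linarith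
    qed
    have gap: "measure_pmf.expectation (history_pmf n b p (2 * N))
        (\<lambda>hs. F (fst (sarah_fw d n b f (step_size p (2 * N)) x0 lmo hs)) - F xmin) \<le> \<epsilon>"
      if lmo: "valid_lmo d n b p X f (step_size p (2 * N)) x0 (2 * N) lmo" for lmo
    proof -
      have "(1 - p / 2) ^ N \<le> exp (- (p / 2)) ^ N"
        using p exp_ge_add_one_self[of "- (p / 2)"] by (intro power_mono) auto
      also have "\<dots> = exp (- (p / 2 * real N))" by (simp add: exp_of_nat_mult[symmetric] mult.commute)
      also have "\<dots> \<le> exp (- l + - l)"
        using N_lower(2) p by (simp add: field_simps)
      also have "\<dots> = \<epsilon> * \<epsilon>" by (simp only: exp_add exp_l)
      finally have "2 * (1 - p / 2) ^ N * h0 \<le> 2 * (\<epsilon> * \<epsilon>) * h0"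
        using h0 by (intro mult_right_mono) auto
      also have "\<dots> \<le> \<epsilon> / 2" using mult_left_mono[OF \<epsilon>h, of \<epsilon>] \<epsilon>(1) by (simp add: algebra_simps)
      finally have first: "2 * (1 - p / 2) ^ N * h0 \<le> \<epsilon> / 2" .
      have "16 * A \<le> \<epsilon> * (4 / p + real N)"
      proof -
        have "16 * A \<le> \<epsilon> * real N" using N_lower(1) \<epsilon>(1) by (simp add: field_simps)
        also have "\<dots> \<le> \<epsilon> * (4 / p + real N)" using \<epsilon>(1) p by (intro mult_left_mono) auto
        finally show ?thesis .
      qed
      moreover have "0 < 4 / p + real N" using p by (intro add_pos_nonneg) auto
      ultimately have second: "8 * A / (4 / p + real N) \<le> \<epsilon> / 2"
        by (subst pos_divide_le_eq) auto
      show ?thesis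
        using sarah_convergence[OF p_def *(2) N lmo] first second
        unfolding A_def h0_def Lt_eq by linarith
    qed
    define Q where "Q = (1 + Lt * sqrt (real n) / (real b * L)) * (L * D\<^sup>2 / \<epsilon>)"
    have bQ: "real b * Q = (real b + Lt * sqrt (real n) / L) * (L * D\<^sup>2 / \<epsilon>)"
      using b by (simp add: Q_def field_simps)
    have AQ: "A / \<epsilon> \<le> Q"
    proof -
      have "Q = D\<^sup>2 * (L + Lt * sqrt (real n) / real b) / \<epsilon>"
        using L(1) b \<epsilon>(1) by (simp add: Q_def field_simps)
      then show ?thesis
        unfolding A_def using L(1) \<epsilon>(1) by (auto intro!: divide_right_mono mult_left_mono)
    qed
    have nb: "1 \<le> real n / real b" using * by simp
    have "4 / p = 2 * (real n / real b) + 4" using b by (simp add: p_def field_simps)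
    then have "4 / p * l \<le> 6 * (real n / real b) * l"
      using nb l by (intro mult_right_mono) auto
    then have "4 / p * l \<le> 6 * (real n / real b * l)" by (simp only: mult.assoc)
    moreover have "1 \<le> real n / real b * l" using mult_mono[OF nb l] by simp
    moreover have "16 * A / \<epsilon> \<le> 16 * Q" using AQ by simp
    moreover have "0 \<le> Q" using AQ A \<epsilon>(1) divide_pos_pos[of A \<epsilon>] by linarith
    ultimately have K: "real (2 * N) \<le> 32 * (real n / real b * l + Q)"
      using N_upper unfolding of_nat_mult of_nat_numeral distrib_left by linarith
    have "measure_pmf.expectation (history_pmf n b p (2 * N)) (\<lambda>hs. real (oracle_calls n hs))
        = real n + real (2 * N) * (p * real n + (1 - p) * (2 * real b))"
      by (rule expected_oracle_calls) (use n p in auto)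
    also have "p * real n + (1 - p) * (2 * real b) \<le> 4 * real b"
    proof -
      have "(1 - p) * (2 * real b) = p * real n" using b by (simp add: p_def field_simps)
      moreover have "p * real n \<le> 2 * real b" using b by (simp add: p_def field_simps)
      ultimately show ?thesis by simp
    qed
    then have "real n + real (2 * N) * (p * real n + (1 - p) * (2 * real b))
        \<le> real n * l + 32 * (real n / real b * l + Q) * (4 * real b)"
      using K l p b mult_left_mono[OF l, of "real n"] by (intro add_mono mult_mono) auto
    also have "\<dots> = 129 * (real n * l) + 128 * (real b * Q)"
      using b by (simp add: field_simps)
    also have "\<dots> \<le> 129 * (real n * l + real b * Q)" using \<open>0 \<le> Q\<close> by simp
    finally have calls: "measure_pmf.expectation (history_pmf n b p (2 * N)) (\<lambda>hs. real (oracle_calls n hs))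
        \<le> 129 * (real n * l + real b * Q)" .
    have "32 * (real n / real b * l + Q) \<le> 129 * (real n / real b * l + Q)"
      using \<open>0 \<le> Q\<close> \<open>1 \<le> real n / real b * l\<close> by (intro mult_right_mono) auto
    with K have "real (2 * N) \<le> 129 * (real n / real b * l + Q)" by linarith
    with gap calls show ?thesis
      unfolding l_def[symmetric] Q_def[symmetric] bQ[symmetric] by blast
  qed
  with \<epsilon>0 show "\<exists>\<epsilon>0>0. \<forall>\<epsilon>. 0 < \<epsilon> \<and> \<epsilon> \<le> \<epsilon>0 \<longrightarrow> (\<exists>K.
      (\<forall>lmo. valid_lmo d n b (2 * real b / (real n + 2 * real b)) X f
          (step_size (2 * real b / (real n + 2 * real b)) K) x0 K lmo \<longrightarrow>
        measure_pmf.expectation (history_pmf n b (2 * real b / (real n + 2 * real b)) K)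
          (\<lambda>hs. F (fst (sarah_fw d n b f (step_size (2 * real b / (real n + 2 * real b)) K) x0 lmo hs))
            - F xmin) \<le> \<epsilon>) \<and>
      real K \<le> 129 * (real n / real b * ln (1 / \<epsilon>)
        + (1 + sqrt ((1 / real n) * (\<Sum>i=1..n. (Li i)\<^sup>2)) * sqrt (real n) / (real b * L)) * (L * D\<^sup>2 / \<epsilon>)) \<and>
      measure_pmf.expectation (history_pmf n b (2 * real b / (real n + 2 * real b)) K)
          (\<lambda>hs. real (oracle_calls n hs))
        \<le> 129 * (real n * ln (1 / \<epsilon>)
          + (real b + sqrt ((1 / real n) * (\<Sum>i=1..n. (Li i)\<^sup>2)) * sqrt (real n) / L) * (L * D\<^sup>2 / \<epsilon>)))"
    unfolding p_def Lt_def by blast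
qed

end
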